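(* For $R=\mathbb{Z}_9$ and for $R=\mathbb{S}_3=\mathbb{F}_3[X]/(X^2)$ we have $\mathrm{m}_7(R)\le 62$; that is, there is no projective $(63,7)$-arc in $\mathrm{PHG}(2,R)$.
   Context: For a finite chain ring $R$ of length $2$ with residue field $\mathbb{F}_q$, the projective Hjelmslev plane $\mathrm{PHG}(2,R)$ is the incidence structure whose points are the free rank-$1$ submodules of the right module $R_R^3$, whose lines are the free rank-$2$ submodules of $R_R^3$, with incidence given by inclusion. A projective $(k,n)$-arc is a set of $k$ points meeting every line in at most $n$ points. For $0\le n\le q^2+q$, $\mathrm{m}_n(R)$ denotes the largest $k$ such that a projective $(k,n)$-arc exists in $\mathrm{PHG}(2,R)$. *)

theory Defs
  imports Main "HOL-Library.Numeral_Type"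
begin

text \<open>Dual a b represents a + b X with X^2 = 0.\<close>
datatype 'a dual = Dual 'a 'a

instantiation dual :: (comm_ring_1) comm_ring_1
begin
fun plus_dual where "Dual a b + Dual c d = Dual (a + c) (b + d)"
fun minus_dual where "Dual a b - Dual c d = Dual (a - c) (b - d)"
fun uminus_dual where "- Dual a b = Dual (- a) (- b)"
fun times_dual where "Dual a b * Dual c d = Dual (a * c) (a * d + b * c)"
definition zero_dual where "0 = Dual 0 0"
definition one_dual where "1 = Dual 1 0"
instance
proof
  fix x y z :: "'a dual"
  show "x + y + z = x + (y + z)" by (cases x; cases y; cases z) (simp add: add.assoc)
  show "x + y = y + x" by (cases x; cases y) (simp add: add.commute)
  show "0 + x = x" by (cases x) (simp add: zero_dual_def)
  show "- x + x = 0" by (cases x) (simp add: zero_dual_def)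
  show "x - y = x + - y" by (cases x; cases y) simp
  show "x * y * z = x * (y * z)" by (cases x; cases y; cases z) (simp add: algebra_simps)
  show "x * y = y * x" by (cases x; cases y) (simp add: algebra_simps)
  show "(x + y) * z = x * z + y * z" by (cases x; cases y; cases z) (simp add: algebra_simps)
  show "1 * x = x" by (cases x) (simp add: one_dual_def)
  show "(0::'a dual) \<noteq> 1" by (simp add: zero_dual_def one_dual_def)
qed
end

instance dual :: (finite) finite
proof
  have "(UNIV :: 'a dual set) = (\<lambda>(a,b). Dual a b) ` UNIV"
    by (auto, case_tac x, auto)
  moreover have "finite (UNIV :: ('a \<times> 'a) set)" by simp
  ultimately show "finite (UNIV :: 'a dual set)" by (metis finite_imageI)
qed

text \<open>S_3 = F_3[X]/(X^2); the numeral type 3 is Z/3Z = F_3; type 9 is Z_9.\<close>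
type_synonym S3 = "3 dual"

text \<open>Vectors of R^3 (the rings considered are commutative, so the right module
  structure is x \<cdot> a componentwise).\<close>
type_synonym 'r vec3 = "'r \<times> 'r \<times> 'r"

fun vsc :: "'r::comm_ring_1 vec3 \<Rightarrow> 'r \<Rightarrow> 'r vec3" where
  "vsc (x, y, z) a = (x * a, y * a, z * a)"

fun vadd :: "'r::comm_ring_1 vec3 \<Rightarrow> 'r vec3 \<Rightarrow> 'r vec3" where
  "vadd (x, y, z) (x', y', z') = (x + x', y + y', z + z')"

definition is_point :: "'r::comm_ring_1 vec3 set \<Rightarrow> bool" where
  "is_point M \<longleftrightarrow> (\<exists>v. M = range (vsc v) \<and> inj (vsc v))"

definition is_line :: "'r::comm_ring_1 vec3 set \<Rightarrow> bool" where
  "is_line M \<longleftrightarrow> (\<exists>u w. M = range (\<lambda>(a, b). vadd (vsc u a) (vsc w b))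
                        \<and> inj (\<lambda>(a, b). vadd (vsc u a) (vsc w b)))"

definition proj_arc :: "'r::comm_ring_1 vec3 set set \<Rightarrow> nat \<Rightarrow> nat \<Rightarrow> bool" where
  "proj_arc S k n \<longleftrightarrow> S \<subseteq> Collect is_point \<and> card S = k \<and>
     (\<forall>L. is_line L \<longrightarrow> card {P \<in> S. P \<subseteq> L} \<le> n)"

definition max_arc :: "'r::{comm_ring_1,finite} itself \<Rightarrow> nat \<Rightarrow> nat" where
  "max_arc _ n = Max {k. \<exists>S :: 'r vec3 set set. proj_arc S k n}"

end

theory Submission
  imports Defs
begin

text \<open>The 117 points fall into 13 neighbour classes of 9 points, each an affine plane of order 3; dually
  the 9 lines of a line class form a dual affine plane. Given an arc of 63 points, let \<open>u x\<close> be its number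
  of points in the class \<open>x\<close> and \<open>N h\<close> the sum of \<open>u\<close> over the four classes on the line class \<open>h\<close>.
  If a segment of direction \<open>h\<close> in the class \<open>x\<close> carries \<open>s\<close> points, the three lines through it give
  \<open>N h + 3 s \<le> 21 + u x\<close>. Combined with \<open>\<Sum>N h = 63 + 3 u x\<close> over the four \<open>h\<close> through \<open>x\<close> and
  \<open>\<Sum>s\<^sup>2 = (u x)\<^sup>2 + 3 u x\<close> over all segments of \<open>x\<close>, this leaves only \<open>u x \<le> 4\<close> and \<open>u x = 6\<close>. In the
  latter case exactly one line class through \<open>x\<close> has \<open>N h = 18\<close>, the other three have \<open>N h = 21\<close>, and the
  segments of \<open>x\<close> in the exceptional direction carry 3, 3 and 0 points. Two classes with 6 points cannot share their
  exceptional line class, so this line class splits as 6 + 4 + 4 + 4. But a class with 4 points only lies on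
  line classes with \<open>N h \<le> 19\<close>, so a second class with 6 points would have several exceptional line classes.\<close>

section \<open>Orthogonal partitions of a nine-element set\<close>

text \<open>A family of partitions of a 9-set into three labelled segments, any two of them orthogonal; with four
  directions this is the affine plane of order 3.\<close>
definition net :: "'h set \<Rightarrow> ('h \<Rightarrow> 'p \<Rightarrow> int) \<Rightarrow> 'p set \<Rightarrow> bool" where
  "net H \<sigma> P \<longleftrightarrow> finite P \<and> card P = 9 \<and> (\<forall>h\<in>H. \<forall>p\<in>P. \<sigma> h p \<in> {0, 1, 2}) \<and>
     (\<forall>h\<in>H. \<forall>h'\<in>H. h \<noteq> h' \<longrightarrow> inj_on (\<lambda>p. (\<sigma> h p, \<sigma> h' p)) P)"

lemma net_bij:
  assumes "net H \<sigma> P" "h \<in> H" "h' \<in> H" "h \<noteq> h'"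
  shows "bij_betw (\<lambda>p. (\<sigma> h p, \<sigma> h' p)) P ({0, 1, 2} \<times> {0, 1, 2})"
proof -
  let ?f = "\<lambda>p. (\<sigma> h p, \<sigma> h' p)"
  have inj: "inj_on ?f P" using assms by (auto simp: net_def)
  have sub: "?f ` P \<subseteq> {0, 1, 2} \<times> {0, 1, 2}"
    using assms unfolding net_def by blast
  have "card (?f ` P) = 9" using inj assms(1) by (simp add: card_image net_def)
  then have "?f ` P = {0, 1, 2} \<times> {0, 1, 2}"
    by (intro card_subset_eq sub) auto
  then show ?thesis using inj by (simp add: bij_betw_def)
qed

lemma net_bij_on_segment:
  assumes "net H \<sigma> P" "h \<in> H" "h' \<in> H" "h \<noteq> h'" "j \<in> {0, 1, 2}"
  shows "bij_betw (\<sigma> h') {p \<in> P. \<sigma> h p = j} {0, 1, 2}"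
proof -
  note b = net_bij[OF assms(1-4)]
  have "inj_on (\<sigma> h') {p \<in> P. \<sigma> h p = j}"
    using b by (auto simp: bij_betw_def inj_on_def)
  moreover have "\<sigma> h' ` {p \<in> P. \<sigma> h p = j} = {0, 1, 2}"
  proof (intro equalityI subsetI)
    fix i assume "i \<in> \<sigma> h' ` {p \<in> P. \<sigma> h p = j}"
    then show "i \<in> {0, 1, 2}" using assms(1,3) unfolding net_def by blast
  next
    fix i :: int assume "i \<in> {0, 1, 2}"
    then have "(j, i) \<in> (\<lambda>p. (\<sigma> h p, \<sigma> h' p)) ` P"
      using b assms(5) unfolding bij_betw_def by blast
    then show "i \<in> \<sigma> h' ` {p \<in> P. \<sigma> h p = j}" by auto
  qed
  ultimately show ?thesis by (simp add: bij_betw_def)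
qed

lemma net_card_segment:
  assumes "net H \<sigma> P" "h \<in> H" "h' \<in> H" "h \<noteq> h'" "j \<in> {0, 1, 2}"
  shows "card {p \<in> P. \<sigma> h p = j} = 3"
  using bij_betw_same_card[OF net_bij_on_segment[OF assms]] by simp

text \<open>The four segments through \<open>p\<close> contain two further points each and, by
  orthogonality, share only \<open>p\<close>, so together they exhaust the other eight
  points.\<close>

lemma net_pair_collinear:
  assumes net: "net H \<sigma> P" and H: "finite H" "card H = 4" and pq: "p \<in> P" "q \<in> P"
  shows "\<exists>h\<in>H. \<sigma> h p = \<sigma> h q"
proof (cases "p = q")
  case True
  with H show ?thesis by (metis card.empty equals0I zero_neq_numeral)
next
  case False
  define Q where "Q h = {r \<in> P. \<sigma> h r = \<sigma> h p} - {p}" for h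
  have P: "finite P" "card P = 9" using net by (auto simp: net_def)
  have "card (Q h) = 2" if h: "h \<in> H" for h
  proof -
    have "card (H - {h}) = 3" using H h by simp
    then have "H - {h} \<noteq> {}" by (metis card.empty zero_neq_numeral)
    then obtain h' where "h' \<in> H" "h \<noteq> h'" by blast
    then have "card {r \<in> P. \<sigma> h r = \<sigma> h p} = 3"
      using net h pq by (intro net_card_segment[OF net h]) (auto simp: net_def)
    then show ?thesis using pq by (simp add: Q_def)
  qed
  moreover have "Q h \<inter> Q h' = {}" if "h \<in> H" "h' \<in> H" "h \<noteq> h'" for h h'
    using that net pq(1) unfolding Q_def net_def inj_on_def by blast
  moreover have "finite (Q h)" for h using P by (simp add: Q_def)
  ultimately have "card (\<Union>h\<in>H. Q h) = 8"
    using H by (subst card_UN_disjoint) auto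
  moreover have "(\<Union>h\<in>H. Q h) \<subseteq> P - {p}" by (auto simp: Q_def)
  moreover have "card (P - {p}) = 8" using P pq by simp
  ultimately have "(\<Union>h\<in>H. Q h) = P - {p}"
    using P by (intro card_subset_eq) auto
  then have "q \<in> (\<Union>h\<in>H. Q h)" using False pq by simp
  then show ?thesis by (auto simp: Q_def intro: sym)
qed

text \<open>Both sides count agreements of ordered pairs from \<open>A\<close>: a diagonal pair
  agrees in all four directions, any other pair in at least one.\<close>

lemma net_second_moment:
  assumes net: "net H \<sigma> P" and H: "finite H" "card H = 4" and A: "A \<subseteq> P"
  shows "(card A)\<^sup>2 + 3 * card A \<le> (\<Sum>h\<in>H. \<Sum>j\<in>{0, 1, 2}. (card {p \<in> A. \<sigma> h p = j})\<^sup>2)"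
proof -
  have fin: "finite A" using A net finite_subset by (auto simp: net_def)
  \<comment> \<open>The sum of squares in direction \<open>h\<close> counts the ordered pairs lying
    in a common segment.\<close>
  have sq: "(\<Sum>j\<in>{0, 1, 2}. (card {p \<in> A. \<sigma> h p = j})\<^sup>2)
      = (\<Sum>p\<in>A. \<Sum>q\<in>A. of_bool (\<sigma> h p = \<sigma> h q))" if h: "h \<in> H" for h
  proof -
    have "(\<Sum>q\<in>A. of_bool (\<sigma> h p = \<sigma> h q)) = card {q \<in> A. \<sigma> h q = \<sigma> h p}" for p
      using fin by (simp add: sum.If_cases of_bool_def Int_def eq_commute)
    then have "(\<Sum>p\<in>A. \<Sum>q\<in>A. of_bool (\<sigma> h p = \<sigma> h q))
        = (\<Sum>p\<in>A. card {q \<in> A. \<sigma> h q = \<sigma> h p})" by simp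
    also have "\<dots> = (\<Sum>j\<in>{0, 1, 2}. \<Sum>p\<in>{p \<in> A. \<sigma> h p = j}. card {q \<in> A. \<sigma> h q = \<sigma> h p})"
      using fin h A net by (intro sum.group[symmetric]) (auto simp: net_def)
    also have "\<dots> = (\<Sum>j\<in>{0, 1, 2}. (card {p \<in> A. \<sigma> h p = j})\<^sup>2)"
      by (intro sum.cong refl) (simp add: power2_eq_square)
    finally show ?thesis by simp
  qed
  have "(card A)\<^sup>2 + 3 * card A = (\<Sum>p\<in>A. \<Sum>q\<in>A. 1 + (if p = q then 3 else 0))"
    unfolding sum.distrib using fin by (simp add: power2_eq_square)
  also have "\<dots> \<le> (\<Sum>p\<in>A. \<Sum>q\<in>A. \<Sum>h\<in>H. of_bool (\<sigma> h p = \<sigma> h q))"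
  proof (intro sum_mono)
    fix p q assume pq: "p \<in> A" "q \<in> A"
    then obtain h where h: "h \<in> H" "\<sigma> h p = \<sigma> h q"
      using net_pair_collinear[OF net H] A by blast
    show "1 + (if p = q then 3 else 0) \<le> (\<Sum>h\<in>H. of_bool (\<sigma> h p = \<sigma> h q) :: nat)"
    proof (cases "p = q")
      case False
      have "(1::nat) = of_bool (\<sigma> h p = \<sigma> h q)" using h by simp
      also have "\<dots> \<le> (\<Sum>h\<in>H. of_bool (\<sigma> h p = \<sigma> h q))"
        using h H by (intro member_le_sum) auto
      finally show ?thesis using False by simp
    qed (use H in simp)
  qed
  also have "\<dots> = (\<Sum>h\<in>H. \<Sum>p\<in>A. \<Sum>q\<in>A. of_bool (\<sigma> h p = \<sigma> h q))"
  proof -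
    have "(\<Sum>p\<in>A. \<Sum>q\<in>A. \<Sum>h\<in>H. of_bool (\<sigma> h p = \<sigma> h q)) = (\<Sum>p\<in>A. \<Sum>h\<in>H. \<Sum>q\<in>A. of_bool (\<sigma> h p = \<sigma> h q) :: nat)"
      by (intro sum.cong refl sum.swap)
    then show ?thesis by (subst sum.swap) simp
  qed
  also have "\<dots> = (\<Sum>h\<in>H. \<Sum>j\<in>{0, 1, 2}. (card {p \<in> A. \<sigma> h p = j})\<^sup>2)"
    by (intro sum.cong refl sq[symmetric])
  finally show ?thesis .
qed

text \<open>Add the hypothesis over the three net elements with label \<open>j\<close> in direction
  \<open>x\<close>. They count \<open>w x j\<close> three times, while for
  \<open>y \<noteq> x\<close> they take each label exactly once.\<close>

lemma net_weight_bound: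
  fixes w :: "'h \<Rightarrow> int \<Rightarrow> nat"
  assumes net: "net Y \<tau> M" and Y: "finite Y" and card: "2 \<le> card Y" and x: "x \<in> Y" and j: "j \<in> {0, 1, 2}"
    and le: "\<And>m. m \<in> M \<Longrightarrow> (\<Sum>y\<in>Y. w y (\<tau> y m)) \<le> n"
  shows "(\<Sum>y\<in>Y. \<Sum>i\<in>{0, 1, 2}. w y i) + 3 * w x j \<le> 3 * n + (\<Sum>i\<in>{0, 1, 2}. w x i)"
proof -
  let ?M = "{m \<in> M. \<tau> x m = j}"
  have "Y \<noteq> {x}" using card by auto
  then obtain x' where "x' \<in> Y" "x \<noteq> x'" using x by auto
  then have cM: "card ?M = 3" using net_card_segment[OF net x _ _ j] by blast
  have "(\<Sum>y\<in>Y. \<Sum>m\<in>?M. w y (\<tau> y m)) = (\<Sum>m\<in>?M. \<Sum>y\<in>Y. w y (\<tau> y m))"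
    by (rule sum.swap)
  also have "\<dots> \<le> 3 * n"
    using sum_bounded_above[of ?M "\<lambda>m. \<Sum>y\<in>Y. w y (\<tau> y m)" n] le cM by auto
  finally have *: "(\<Sum>y\<in>Y. \<Sum>m\<in>?M. w y (\<tau> y m)) \<le> 3 * n" .
  have "(\<Sum>m\<in>?M. w x (\<tau> x m)) = 3 * w x j" using cM by simp
  moreover have "(\<Sum>y\<in>Y - {x}. \<Sum>m\<in>?M. w y (\<tau> y m)) = (\<Sum>y\<in>Y - {x}. \<Sum>i\<in>{0, 1, 2}. w y i)"
    using net_bij_on_segment[OF net x _ _ j]
    by (intro sum.cong refl sum.reindex_bij_betw) auto
  ultimately show ?thesis
    using * sum.remove[OF Y x, of "\<lambda>y. \<Sum>m\<in>?M. w y (\<tau> y m)"]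
      sum.remove[OF Y x, of "\<lambda>y. \<Sum>i\<in>{0, 1, 2}. w y i"] by linarith
qed

text \<open>The four elements of the net avoiding a segment in each of two directions meet every segment
  of any other direction.\<close>
lemma net_two_full_bound:
  fixes w :: "'h \<Rightarrow> int \<Rightarrow> nat"
  assumes net: "net Y \<tau> M" and Y: "finite Y" and x: "x \<in> Y" "x' \<in> Y" "x \<noteq> x'"
    and j: "j \<in> {0, 1, 2}" "j' \<in> {0, 1, 2}"
    and w: "\<And>i. i \<in> {0, 1, 2} - {j} \<Longrightarrow> w x i = 3" "\<And>i. i \<in> {0, 1, 2} - {j'} \<Longrightarrow> w x' i = 3"
    and le: "\<And>m. m \<in> M \<Longrightarrow> (\<Sum>y\<in>Y. w y (\<tau> y m)) \<le> 7"
  shows "(\<Sum>y\<in>Y - {x, x'}. \<Sum>i\<in>{0, 1, 2}. w y i) \<le> 4"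
proof -
  define G where "G = {m \<in> M. \<tau> x m \<noteq> j \<and> \<tau> x' m \<noteq> j'}"
  have finG: "finite G" using net by (auto simp: G_def net_def)
  let ?f = "\<lambda>m. (\<tau> x m, \<tau> x' m)"
  have img: "?f ` G = ({0, 1, 2} - {j}) \<times> ({0, 1, 2} - {j'})"
  proof -
    have "?f ` M = {0, 1, 2} \<times> {0, 1, 2}"
      using net_bij[OF net x] by (rule bij_betw_imp_surj_on)
    moreover have "?f ` G = ?f ` M \<inter> ((- {j}) \<times> (- {j'}))" by (auto simp: G_def)
    ultimately show ?thesis by auto
  qed
  have c: "card ({0, 1, 2} - {j}) = 2" "card ({0, 1, 2} - {j'}) = 2" using j by auto
  have "inj_on ?f G"
    using net_bij[OF net x] by (auto simp: bij_betw_def G_def inj_on_def)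
  then have "card G = card (?f ` G)" by (rule card_image[symmetric])
  then have cG: "card G = 4" unfolding img card_cartesian_product c by simp
  \<comment> \<open>On \<open>G\<close> the directions \<open>x\<close> and \<open>x'\<close> use up
    6 of the allowed weight 7, so all others together contribute at most 1.\<close>
  have 3: "w x (\<tau> x m) = 3" "w x' (\<tau> x' m) = 3" if "m \<in> G" for m
    using that net x by (auto simp: G_def net_def intro!: w)
  have hit: "{0, 1, 2} \<subseteq> \<tau> y ` G" if y: "y \<in> Y - {x, x'}" for y
  proof
    fix i :: int assume i: "i \<in> {0, 1, 2}"
    let ?S = "{m \<in> M. \<tau> y m = i}"
    have b: "bij_betw (\<tau> x) ?S {0, 1, 2}" "bij_betw (\<tau> x') ?S {0, 1, 2}"
      using net_bij_on_segment[OF net _ _ _ i] y x by auto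
    have "j \<in> \<tau> x ` ?S" "j' \<in> \<tau> x' ` ?S" using b j unfolding bij_betw_def by blast+
    then obtain m0 m1 where m: "m0 \<in> ?S" "\<tau> x m0 = j" "m1 \<in> ?S" "\<tau> x' m1 = j'" by blast
    have "card ?S = 3" using bij_betw_same_card[OF b(1)] by simp
    moreover have "card {m0, m1} \<le> 2" by (simp add: card_insert_if)
    ultimately have "\<not> ?S \<subseteq> {m0, m1}" using card_mono[of "{m0, m1}" ?S] by auto
    \<comment> \<open>One element of the three-element segment has label \<open>j\<close> for
      \<open>x\<close>, one has \<open>j'\<close> for \<open>x'\<close>; a third therefore avoids
      both labels.\<close>
    then obtain k where "k \<in> ?S" "k \<noteq> m0" "k \<noteq> m1" by blast
    then have "k \<in> G" using b m unfolding G_def bij_betw_def inj_on_def by blast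
    then show "i \<in> \<tau> y ` G" using \<open>k \<in> ?S\<close> by blast
  qed
  have "(\<Sum>y\<in>Y - {x, x'}. \<Sum>i\<in>{0, 1, 2}. w y i) \<le> (\<Sum>y\<in>Y - {x, x'}. \<Sum>m\<in>G. w y (\<tau> y m))"
  proof (rule sum_mono)
    fix y assume y: "y \<in> Y - {x, x'}"
    have "(\<Sum>i\<in>{0, 1, 2}. w y i) \<le> (\<Sum>i\<in>\<tau> y ` G. w y i)"
      using hit[OF y] finG by (intro sum_mono2) auto
    also have "\<dots> \<le> (\<Sum>m\<in>G. w y (\<tau> y m))"
      using sum_image_le[OF finG, of "w y" "\<tau> y"] by (simp add: comp_def)
    finally show "(\<Sum>i\<in>{0, 1, 2}. w y i) \<le> (\<Sum>m\<in>G. w y (\<tau> y m))" .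
  qed
  also have "\<dots> = (\<Sum>m\<in>G. \<Sum>y\<in>Y - {x, x'}. w y (\<tau> y m))" by (rule sum.swap)
  also have "\<dots> \<le> (\<Sum>m\<in>G. 1)"
  proof (rule sum_mono)
    fix m assume m: "m \<in> G"
    have "(\<Sum>y\<in>Y. w y (\<tau> y m)) = (\<Sum>y\<in>Y - {x, x'}. w y (\<tau> y m)) + (\<Sum>y\<in>{x, x'}. w y (\<tau> y m))"
      using Y x by (intro sum.subset_diff) auto
    then show "(\<Sum>y\<in>Y - {x, x'}. w y (\<tau> y m)) \<le> 1"
      using le[of m] m 3[OF m] x by (auto simp: G_def)
  qed
  finally show ?thesis using cG by simp
qed

text \<open>Here \<open>n\<close> stands for \<open>N h\<close>, and 26 = 21 + 5. A part of size at
  least 3 forces \<open>n \<le> 17\<close>; otherwise the parts are 2, 2, 1 with squares summing to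
  9.\<close>

lemma five_profile:
  fixes a b c :: nat
  assumes "a + b + c = 5" "n + 3 * a \<le> 26" "n + 3 * b \<le> 26" "n + 3 * c \<le> 26"
  shows "n \<le> 17 \<or> n \<le> 20 \<and> a\<^sup>2 + b\<^sup>2 + c\<^sup>2 \<le> 9"
proof (cases "a \<le> 2 \<and> b \<le> 2 \<and> c \<le> 2")
  case True
  then have "a \<in> {0, 1, 2}" "b \<in> {0, 1, 2}" by auto
  with assms True show ?thesis by auto
qed (use assms in linarith)

text \<open>Now 27 = 21 + 6. The three alternatives are: a part of size at least 4; largest part 3,
  hence 3, 2, 1 or 3, 3, 0; and 2, 2, 2.\<close>

lemma six_profile:
  fixes a b c :: nat
  assumes "a + b + c = 6" "n + 3 * a \<le> 27" "n + 3 * b \<le> 27" "n + 3 * c \<le> 27"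
  shows "n \<le> 15 \<or> n \<le> 18 \<and> (a\<^sup>2 + b\<^sup>2 + c\<^sup>2 \<le> 14 \<or>
            a\<^sup>2 + b\<^sup>2 + c\<^sup>2 = 18 \<and> (a, b, c) \<in> {(0, 3, 3), (3, 0, 3), (3, 3, 0)})
       \<or> n \<le> 21 \<and> a\<^sup>2 + b\<^sup>2 + c\<^sup>2 = 12"
proof (cases "a \<le> 3 \<and> b \<le> 3 \<and> c \<le> 3")
  case True
  have "a = 0 \<or> a = 1 \<or> a = 2 \<or> a = 3" "b = 0 \<or> b = 1 \<or> b = 2 \<or> b = 3" using True by linarith+
  moreover have "c = 6 - a - b" "c \<le> 3" "a + b \<le> 6" using assms True by simp_all
  ultimately show ?thesis using assms(2-4) by (elim disjE) simp_all
qed (use assms in linarith)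

section \<open>The counting argument for an arc of 63 points\<close>

text \<open>\<open>X\<close> indexes both the point classes and the line classes. The point \<open>(x, p)\<close> lies on the line
  \<open>(h, m)\<close> iff \<open>inc x h\<close> and the segment \<open>\<sigma> x h p\<close> of the point is the segment \<open>\<tau> h x m\<close> cut out by the
  line in the class \<open>x\<close>.\<close>
locale arc63 =
  fixes X :: "'a set" and inc :: "'a \<Rightarrow> 'a \<Rightarrow> bool" and P :: "'p set"
    and \<sigma> \<tau> :: "'a \<Rightarrow> 'a \<Rightarrow> 'p \<Rightarrow> int" and A :: "('a \<times> 'p) set"
  assumes finite_X: "finite X" and card_X: "card X = 13"
    and inc_sym: "inc x h \<longleftrightarrow> inc h x"
    and card_lines: "x \<in> X \<Longrightarrow> card {h \<in> X. inc x h} = 4"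
    and card_join: "x \<in> X \<Longrightarrow> y \<in> X \<Longrightarrow> x \<noteq> y \<Longrightarrow> card {h \<in> X. inc x h \<and> inc y h} = 1"
    and net_points: "x \<in> X \<Longrightarrow> net {h \<in> X. inc x h} (\<sigma> x) P"
    and net_lines: "h \<in> X \<Longrightarrow> net {x \<in> X. inc x h} (\<tau> h) P"
    and A_sub: "A \<subseteq> X \<times> P" and card_A: "card A = 63"
    and line_le: "h \<in> X \<Longrightarrow> m \<in> P \<Longrightarrow> card {(x, p) \<in> A. inc x h \<and> \<sigma> x h p = \<tau> h x m} \<le> 7"
begin

definition u :: "'a \<Rightarrow> nat" where "u x = card {p. (x, p) \<in> A}"

definition N :: "'a \<Rightarrow> nat" where "N h = (\<Sum>x\<in>{x \<in> X. inc x h}. u x)"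

definition seg :: "'a \<Rightarrow> 'a \<Rightarrow> int \<Rightarrow> nat" where
  "seg x h j = card {p \<in> {p. (x, p) \<in> A}. \<sigma> x h p = j}"

lemma finite_P: "finite P" and card_P: "card P = 9"
proof -
  obtain x where "x \<in> X" using card_X by fastforce
  from net_points[OF this] show "finite P" "card P = 9" by (auto simp: net_def)
qed

lemma fibre_sub: "{p. (x, p) \<in> A} \<subseteq> P"
  using A_sub by auto

lemma u_le_9: "u x \<le> 9"
  unfolding u_def using card_mono[OF finite_P fibre_sub] card_P by simp

lemma card_points: "h \<in> X \<Longrightarrow> card {x \<in> X. inc x h} = 4"
  using card_lines[of h] by (simp add: inc_sym[of _ h])

lemma sum_u: "(\<Sum>x\<in>X. u x) = 63"
proof -
  have "A = (SIGMA x:X. {p. (x, p) \<in> A})" using A_sub by auto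
  moreover have "card (SIGMA x:X. {p. (x, p) \<in> A}) = (\<Sum>x\<in>X. u x)"
    unfolding u_def using finite_subset[OF fibre_sub finite_P] finite_X by simp
  ultimately show ?thesis using card_A by simp
qed

lemma sum_seg:
  assumes "x \<in> X" "h \<in> X" "inc x h"
  shows "(\<Sum>j\<in>{0, 1, 2}. seg x h j) = u x"
proof -
  have "(\<Sum>j\<in>{0, 1, 2}. \<Sum>p\<in>{p \<in> {p. (x, p) \<in> A}. \<sigma> x h p = j}. 1) = (\<Sum>p\<in>{p. (x, p) \<in> A}. 1 :: nat)"
    using finite_subset[OF fibre_sub finite_P] net_points[OF assms(1)] assms fibre_sub[of x]
    by (intro sum.group) (auto simp: net_def)
  then show ?thesis by (simp add: seg_def u_def)
qed

lemma line_sum: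
  assumes "h \<in> X" "m \<in> P"
  shows "(\<Sum>x\<in>{x \<in> X. inc x h}. seg x h (\<tau> h x m)) \<le> 7"
proof -
  have "{(x, p) \<in> A. inc x h \<and> \<sigma> x h p = \<tau> h x m}
      = (SIGMA x:{x \<in> X. inc x h}. {p \<in> {p. (x, p) \<in> A}. \<sigma> x h p = \<tau> h x m})"
    using A_sub by auto
  moreover have "card \<dots> = (\<Sum>x\<in>{x \<in> X. inc x h}. seg x h (\<tau> h x m))"
    unfolding seg_def using finite_subset[OF fibre_sub finite_P] finite_X by simp
  ultimately show ?thesis using line_le[OF assms] by simp
qed

text \<open>This is \<open>net_weight_bound\<close> for the dual net of the line class
  \<open>h\<close>, weighted by segment sizes; 21 is three lines with at most 7 points each.\<close>

lemma N_le:
  assumes "x \<in> X" "h \<in> X" "inc x h" "j \<in> {0, 1, 2}"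
  shows "N h + 3 * seg x h j \<le> 21 + u x"
proof -
  have N: "N h = (\<Sum>y\<in>{x \<in> X. inc x h}. \<Sum>i\<in>{0, 1, 2}. seg y h i)"
    unfolding N_def using sum_seg assms(2) by (intro sum.cong refl) (auto simp del: sum.insert)
  have "(\<Sum>y\<in>{x \<in> X. inc x h}. \<Sum>i\<in>{0, 1, 2}. seg y h i) + 3 * seg x h j
      \<le> 3 * 7 + (\<Sum>i\<in>{0, 1, 2}. seg x h i)"
    using assms finite_X card_points line_sum
    by (intro net_weight_bound[OF net_lines[OF assms(2)]]) auto
  then show ?thesis using N sum_seg[OF assms(1-3)] by simp
qed

text \<open>Double counting: each class other than \<open>x\<close> shares exactly one line class
  with \<open>x\<close>, while \<open>x\<close> itself is counted four times.\<close>

lemma sum_N: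
  assumes x: "x \<in> X"
  shows "(\<Sum>h\<in>{h \<in> X. inc x h}. N h) = 63 + 3 * u x"
proof -
  have "(\<Sum>h\<in>{h \<in> X. inc x h}. N h) = (\<Sum>h\<in>{h \<in> X. inc x h}. \<Sum>y\<in>X. if inc y h then u y else 0)"
    unfolding N_def using finite_X by (simp add: sum.If_cases Int_def)
  also have "\<dots> = (\<Sum>y\<in>X. \<Sum>h\<in>{h \<in> X. inc x h}. if inc y h then u y else 0)"
    by (rule sum.swap)
  also have "\<dots> = (\<Sum>y\<in>X. card {h \<in> X. inc x h \<and> inc y h} * u y)"
    using finite_X by (simp add: sum.If_cases Int_def conj_assoc)
  also have "\<dots> = (\<Sum>y\<in>X. u y + (if x = y then 3 * u y else 0))"
    using x card_join card_lines by (intro sum.cong refl) auto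
  also have "\<dots> = 63 + 3 * u x"
    unfolding sum.distrib using finite_X x sum_u by simp
  finally show ?thesis .
qed

lemma obtain_lines:
  assumes "x \<in> X"
  obtains a b c d where "{h \<in> X. inc x h} = {a, b, c, d}" "distinct [a, b, c, d]"
proof -
  obtain xs where xs: "set xs = {h \<in> X. inc x h}" "distinct xs"
    using finite_distinct_list[of "{h \<in> X. inc x h}"] finite_X by auto
  then have "length xs = 4" using card_lines[OF assms] distinct_card by fastforce
  then obtain a b c d where "xs = [a, b, c, d]"
    by (auto simp: length_Suc_conv numeral_eq_Suc)
  with xs that show thesis by (metis list.set(1,2))
qed

lemma second_moment:
  assumes "x \<in> X"
  shows "(u x)\<^sup>2 + 3 * u x \<le> (\<Sum>h\<in>{h \<in> X. inc x h}. (seg x h 0)\<^sup>2 + (seg x h 1)\<^sup>2 + (seg x h 2)\<^sup>2)"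
proof -
  have "(u x)\<^sup>2 + 3 * u x \<le> (\<Sum>h\<in>{h \<in> X. inc x h}. \<Sum>j\<in>{0, 1, 2}. (seg x h j)\<^sup>2)"
    unfolding u_def seg_def
    using net_second_moment[OF net_points[OF assms] _ _ fibre_sub] finite_X card_lines[OF assms] by simp
  then show ?thesis by (simp add: add.assoc)
qed

lemma u_cases:
  assumes x: "x \<in> X"
  shows "u x \<le> 4 \<or> u x = 6"
proof (rule ccontr)
  assume "\<not> ?thesis"
  then have "u x = 5 \<or> 7 \<le> u x" by auto
  then show False
  proof
    assume 7: "7 \<le> u x"
    \<comment> \<open>Seven points in three segments put at least 3 into one of them, and 21 - 9 =
      12.\<close>
    have "N h \<le> 12 + u x" if "h \<in> {h \<in> X. inc x h}" for h
    proof -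
      have "3 \<le> seg x h 0 \<or> 3 \<le> seg x h 1 \<or> 3 \<le> seg x h 2"
        using sum_seg[of x h] that x 7 by (simp, linarith)
      then show ?thesis using N_le[of x h 0] N_le[of x h 1] N_le[of x h 2] that x by auto
    qed
    then have "63 + 3 * u x \<le> 4 * (12 + u x)"
      using sum_bounded_above[of "{h \<in> X. inc x h}" N "12 + u x"] sum_N[OF x] card_lines[OF x] by simp
    then show False using u_le_9[of x] by simp
  next
    assume 5: "u x = 5"
    obtain a b c d where H: "{h \<in> X. inc x h} = {a, b, c, d}" "distinct [a, b, c, d]"
      using obtain_lines[OF x] .
    have p: "N h \<le> 17 \<or> N h \<le> 20 \<and> (seg x h 0)\<^sup>2 + (seg x h 1)\<^sup>2 + (seg x h 2)\<^sup>2 \<le> 9"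
      if "h \<in> {a, b, c, d}" for h
      using N_le[of x h] sum_seg[of x h] x 5 that[folded H(1)] by (intro five_profile) auto
    have "N a + N b + N c + N d = 78" using sum_N[OF x] H 5 by simp
    moreover have "40 \<le> (\<Sum>h\<in>{a, b, c, d}. (seg x h 0)\<^sup>2 + (seg x h 1)\<^sup>2 + (seg x h 2)\<^sup>2)"
      using second_moment[OF x] 5 H by simp
    \<comment> \<open>Four directions with square sum at most 9 give only 36 < 40, so some direction
      has \<open>N h \<le> 17\<close>; then the total is at most 17 + 3 * 20 = 77 < 78.\<close>
    ultimately show False using p[of a] p[of b] p[of c] p[of d] H(2) by (simp, linarith)
  qed
qed

text \<open>Square sums of 12 in all four directions give 48 < 54, so some direction
  \<open>e\<close> deviates and has \<open>N e \<le> 18\<close>. The total 81 = 18 + 3 * 21 then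
  forces equality everywhere; the other square sums are 12, leaving at least 18 for
  \<open>e\<close>, which only the profile 3, 3, 0 attains.\<close>

lemma u_six:
  assumes x: "x \<in> X" and 6: "u x = 6"
  obtains h j where "h \<in> X" "inc x h" "N h = 18" "j \<in> {0, 1, 2}"
    "\<forall>i\<in>{0, 1, 2} - {j}. seg x h i = 3" "\<forall>k\<in>X. inc x k \<longrightarrow> k \<noteq> h \<longrightarrow> N k = 21"
proof -
  define q where "q h = (seg x h 0)\<^sup>2 + (seg x h 1)\<^sup>2 + (seg x h 2)\<^sup>2" for h
  define full where "full h \<longleftrightarrow> (seg x h 0, seg x h 1, seg x h 2) \<in> {(0, 3, 3), (3, 0, 3), (3, 3, 0)}" for h
  obtain a b c d where H: "{h \<in> X. inc x h} = {a, b, c, d}" "distinct [a, b, c, d]"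
    using obtain_lines[OF x] .
  have p: "N h \<le> 15 \<or> N h \<le> 18 \<and> (q h \<le> 14 \<or> q h = 18 \<and> full h) \<or> N h \<le> 21 \<and> q h = 12"
    if "h \<in> {a, b, c, d}" for h
    unfolding q_def full_def
    using N_le[of x h] sum_seg[of x h] x 6 that[folded H(1)] by (intro six_profile) auto
  have "N a + N b + N c + N d = 81" using sum_N[OF x] H 6 by simp
  moreover have "54 \<le> q a + q b + q c + q d"
    using second_moment[OF x, folded q_def] 6 H by simp
  ultimately have tot: "N a + N b + N c + N d = 81" "54 \<le> q a + q b + q c + q d" .
  have key: "N e = 18 \<and> full e \<and> N f = 21 \<and> N g = 21 \<and> N k = 21"
    if "q e \<noteq> 12" "{e, f, g, k} \<subseteq> {a, b, c, d}" "N e + N f + N g + N k = 81"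
      "54 \<le> q e + q f + q g + q k" for e f g k
  proof -
    from that(2) have mem: "e \<in> {a, b, c, d}" "f \<in> {a, b, c, d}" "g \<in> {a, b, c, d}" "k \<in> {a, b, c, d}"
      by auto
    have N21: "N f \<le> 21" "N g \<le> 21" "N k \<le> 21" using p[OF mem(2)] p[OF mem(3)] p[OF mem(4)] by linarith+
    have "N e \<le> 18" using p[OF mem(1)] that(1) by linarith
    with that(3) N21 have eq: "N e = 18" "N f = 21" "N g = 21" "N k = 21" by linarith+
    then have "q f = 12" "q g = 12" "q k = 12" using p[OF mem(2)] p[OF mem(3)] p[OF mem(4)] by simp_all
    with that(4) have "18 \<le> q e" by linarith
    then show ?thesis using eq p[OF mem(1)] that(1) by auto
  qed
  have "q a \<noteq> 12 \<or> q b \<noteq> 12 \<or> q c \<noteq> 12 \<or> q d \<noteq> 12" using tot(2) by auto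
  then have "\<exists>h\<in>{a, b, c, d}. N h = 18 \<and> full h \<and> (\<forall>k\<in>{a, b, c, d}. k \<noteq> h \<longrightarrow> N k = 21)"
  proof (elim disjE)
    assume "q a \<noteq> 12"
    from key[OF this, of b c d] tot show ?thesis by auto
  next
    assume "q b \<noteq> 12"
    from key[OF this, of a c d] tot show ?thesis by auto
  next
    assume "q c \<noteq> 12"
    from key[OF this, of a b d] tot show ?thesis by auto
  next
    assume "q d \<noteq> 12"
    from key[OF this, of a b c] tot show ?thesis by auto
  qed
  then obtain h where h: "h \<in> {h \<in> X. inc x h}" "N h = 18" "full h"
    "\<forall>k\<in>{h \<in> X. inc x h}. k \<noteq> h \<longrightarrow> N k = 21" using H by auto
  have "\<exists>j\<in>{0, 1, 2}. \<forall>i\<in>{0, 1, 2} - {j}. seg x h i = 3"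
    using h(3) by (auto simp: full_def)
  then obtain j where "j \<in> {0, 1, 2}" "\<forall>i\<in>{0, 1, 2} - {j}. seg x h i = 3" ..
  then show thesis using h(1,2,4) by (intro that[of h j]) simp_all
qed

text \<open>By pigeonhole some segment carries two of the four points, and 25 - 6 = 19.\<close>

lemma u_four:
  assumes "x \<in> X" "u x = 4" "h \<in> X" "inc x h"
  shows "N h \<le> 19"
proof -
  have "2 \<le> seg x h 0 \<or> 2 \<le> seg x h 1 \<or> 2 \<le> seg x h 2"
    using sum_seg[of x h] assms by (simp, linarith)
  then show ?thesis using N_le[of x h 0] N_le[of x h 1] N_le[of x h 2] assms by auto
qed

lemma join:
  assumes "x \<in> X" "y \<in> X" "x \<noteq> y"
  obtains h where "h \<in> X" "inc x h" "inc y h"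
  using card_join[OF assms] by (metis (mono_tags, lifting) card_1_singletonE insertI1 mem_Collect_eq)

lemma join_unique:
  assumes "x \<in> X" "y \<in> X" "x \<noteq> y" "h \<in> X" "inc x h" "inc y h" "k \<in> X" "inc x k" "inc y k"
  shows "h = k"
proof -
  obtain l where "{h \<in> X. inc x h \<and> inc y h} = {l}"
    using card_join[OF assms(1-3)] card_1_singletonE by blast
  with assms have "h \<in> {l}" "k \<in> {l}" by blast+
  then show ?thesis by simp
qed

lemma contradiction: False
proof -
  have "\<exists>x\<in>X. u x = 6"
  proof (rule ccontr)
    assume "\<not> ?thesis"
    then have "\<And>x. x \<in> X \<Longrightarrow> u x \<le> 4" using u_cases by blast
    then show False using sum_bounded_above[of X u 4] card_X sum_u by simp
  qed
  then obtain x where x: "x \<in> X" "u x = 6" by blast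
  obtain h j where h: "h \<in> X" "inc x h" "N h = 18" "j \<in> {0, 1, 2}"
    "\<forall>i\<in>{0, 1, 2} - {j}. seg x h i = 3"
    by (rule u_six[OF x])
  let ?Y = "{y \<in> X. inc y h}"
  have Y: "finite ?Y" "card ?Y = 4" "x \<in> ?Y" using finite_X card_points h x by auto
  have rest: "(\<Sum>y\<in>?Y - {x}. u y) = 12"
    using sum.remove[OF Y(1,3), of u] h(3) x by (simp add: N_def)
  have le4: "u y \<le> 4" if y: "y \<in> ?Y - {x}" for y
  proof (rule ccontr)
    assume "\<not> ?thesis"
    then have 6: "u y = 6" using u_cases y by blast
    from y have yX: "y \<in> X" "inc y h" "y \<noteq> x" by auto
    obtain k i where k: "i \<in> {0, 1, 2}" "\<forall>l\<in>{0, 1, 2} - {i}. seg y k l = 3"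
      "\<forall>l\<in>X. inc y l \<longrightarrow> l \<noteq> k \<longrightarrow> N l = 21"
      by (rule u_six[OF yX(1) 6])
    \<comment> \<open>\<open>N h = 18\<close> differs from 21, so \<open>h\<close> must be the
      exceptional line class of \<open>y\<close> as well.\<close>
    have "k = h" using k(3) h(1,3) yX by auto
    then have full: "\<forall>l\<in>{0, 1, 2} - {i}. seg y h l = 3" using k(2) by simp
    \<comment> \<open>With \<open>x\<close> and \<open>y\<close> both of profile 3, 3, 0 on
      \<open>h\<close>, the remaining two classes carry at most 4 points, yet they should carry 12 -
      6 = 6.\<close>
    have "(\<Sum>z\<in>?Y - {x, y}. \<Sum>i\<in>{0, 1, 2}. seg z h i) \<le> 4"
      using Y(3) yX line_sum[OF h(1)] h(5) full
      by (intro net_two_full_bound[OF net_lines[OF h(1)] Y(1) _ _ _ h(4) k(1)]) blast+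
    moreover have "(\<Sum>z\<in>?Y - {x, y}. \<Sum>i\<in>{0, 1, 2}. seg z h i) = (\<Sum>z\<in>?Y - {x, y}. u z)"
      using sum_seg h by (intro sum.cong refl) (auto simp del: sum.insert)
    moreover have "(\<Sum>z\<in>?Y - {x}. u z) = u y + (\<Sum>z\<in>?Y - {x} - {y}. u z)"
      using Y yX by (intro sum.remove) auto
    moreover have "?Y - {x} - {y} = ?Y - {x, y}" by auto
    ultimately show False using rest 6 by simp
  qed
  have card3: "card (?Y - {x}) = 3" using Y by simp
  have eq4: "u y = 4" if y: "y \<in> ?Y - {x}" for y
  proof -
    have "(\<Sum>z\<in>?Y - {x}. u z) = u y + (\<Sum>z\<in>?Y - {x} - {y}. u z)"
      using Y y by (intro sum.remove) auto
    moreover have "(\<Sum>z\<in>?Y - {x} - {y}. u z) \<le> 2 * 4"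
      using sum_bounded_above[of "?Y - {x} - {y}" u 4] le4 card3 y by simp
    ultimately show ?thesis using rest le4[OF y] by simp
  qed
  \<comment> \<open>The nine classes off \<open>h\<close> carry 63 - 18 = 45 points, more than 9 *
    4.\<close>
  have "\<exists>x'\<in>X - ?Y. u x' = 6"
  proof (rule ccontr)
    assume "\<not> ?thesis"
    then have "\<And>z. z \<in> X - ?Y \<Longrightarrow> u z \<le> 4" using u_cases by blast
    moreover have "card (X - ?Y) = 9" using card_X Y finite_X by (subst card_Diff_subset) auto
    ultimately have "(\<Sum>z\<in>X - ?Y. u z) \<le> 36"
      using sum_bounded_above[of "X - ?Y" u 4] by simp
    moreover have "(\<Sum>z\<in>X. u z) = (\<Sum>z\<in>X - ?Y. u z) + (\<Sum>z\<in>?Y. u z)"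
      using finite_X by (intro sum.subset_diff) auto
    ultimately show False using sum_u h(3) by (simp add: N_def)
  qed
  then obtain x' where x': "x' \<in> X" "\<not> inc x' h" "u x' = 6" by blast
  obtain k where k: "\<forall>l\<in>X. inc x' l \<longrightarrow> l \<noteq> k \<longrightarrow> N l = 21"
    by (rule u_six[OF x'(1,3)])
  \<comment> \<open>The line class joining \<open>x'\<close> to a four-point class has
    \<open>N l \<le> 19\<close>, so it can only be the exceptional one \<open>k\<close>.\<close>
  have join_k: "inc y k \<and> k \<in> X \<and> inc x' k" if y: "y \<in> ?Y - {x}" for y
  proof -
    obtain l where l: "l \<in> X" "inc x' l" "inc y l" using join[of x' y] x' y by blast
    with u_four[of y l] eq4[OF y] y have "N l \<le> 19" by simp
    with k l show ?thesis by auto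
  qed
  have "\<not> ?Y - {x} \<subseteq> {y}" for y using card3 card_mono[of "{y}" "?Y - {x}"] by auto
  then obtain y z where "y \<in> ?Y - {x}" "z \<in> ?Y - {x}" "y \<noteq> z" by blast
  \<comment> \<open>Two distinct classes on both \<open>h\<close> and \<open>k\<close> identify
    them, although \<open>x'\<close> lies on \<open>k\<close> and not on \<open>h\<close>.\<close>
  then have "h = k" using join_k h by (intro join_unique[of y z]) auto
  then show False using join_k \<open>y \<in> ?Y - {x}\<close> x'(2) by blast
qed

end

section \<open>Integer coordinates for the classes and their nets\<close>

text \<open>Points and lines of \<open>PG(2,3)\<close>, with first nonzero coordinate 1.\<close>
definition reps :: "(int \<times> int \<times> int) set" where
  "reps = (\<lambda>(a, b). (1, a, b)) ` ({-1, 0, 1} \<times> {-1, 0, 1}) \<union> (\<lambda>b. (0, 1, b)) ` {-1, 0, 1} \<union> {(0, 0, 1)}"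

definition offsets :: "(int \<times> int) set" where
  "offsets = {-1, 0, 1} \<times> {-1, 0, 1}"

text \<open>Offsets are vectors vanishing at the pivot of the representative, so that \<open>x + \<theta> p\<close> stays normalized.\<close>
fun embed :: "int \<times> int \<times> int \<Rightarrow> int \<times> int \<Rightarrow> int \<times> int \<times> int" where
  "embed (x, y, z) (s, t) = (if x = 1 then (0, s, t) else if y = 1 then (s, 0, t) else (s, t, 0))"

fun dot :: "'a::comm_ring_1 vec3 \<Rightarrow> 'a vec3 \<Rightarrow> 'a" where
  "dot (x, y, z) (x', y', z') = x * x' + y * y' + z * z'"

definition inc :: "int \<times> int \<times> int \<Rightarrow> int \<times> int \<times> int \<Rightarrow> bool" where
  "inc x h \<longleftrightarrow> dot x h mod 3 = 0"

lemma dot_commute: "dot v w = dot w v"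
  by (cases v; cases w) (simp add: mult.commute)

lemma dot_vsc: "dot w (vsc v a) = dot w v * a"
  by (cases v; cases w) (simp add: algebra_simps)

lemma finite_offsets: "finite offsets" and card_offsets: "card offsets = 9"
  by (simp_all add: offsets_def)

lemma card_reps: "card reps = 13" 
  by code_simp

text \<open>\<open>Set.filter\<close> keeps this finite check executable; \<open>no_arc\<close>
  translates it to set comprehension.\<close>

lemma card_filter_inc: "\<forall>x\<in>reps. card (Set.filter (inc x) reps) = 4"
  by code_simp

lemma card_filter_join:
  "\<forall>x\<in>reps. \<forall>y\<in>reps. x \<noteq> y \<longrightarrow> card (Set.filter (\<lambda>h. inc x h \<and> inc y h) reps) = 1"
  by code_simp

text \<open>Nine image values on nine offsets encode injectivity, that is, orthogonality of two
  directions, in executable form.\<close>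

lemma card_image_embed:
  "\<forall>x\<in>reps. \<forall>h\<in>Set.filter (inc x) reps. \<forall>h'\<in>Set.filter (inc x) reps. h \<noteq> h' \<longrightarrow>
     card ((\<lambda>p. (dot (embed x p) h mod 3, dot (embed x p) h' mod 3)) ` offsets) = 9"
  by code_simp

lemma inj_on_embed:
  assumes "x \<in> reps" "h \<in> reps" "inc x h" "h' \<in> reps" "inc x h'" "h \<noteq> h'"
  shows "inj_on (\<lambda>p. (dot (embed x p) h mod 3, dot (embed x p) h' mod 3)) offsets"
proof (rule eq_card_imp_inj_on[OF finite_offsets])
  have h: "h \<in> Set.filter (inc x) reps" "h' \<in> Set.filter (inc x) reps" using assms by auto
  show "card ((\<lambda>p. (dot (embed x p) h mod 3, dot (embed x p) h' mod 3)) ` offsets) = card offsets"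
    unfolding card_offsets by (rule card_image_embed[rule_format, OF assms(1) h assms(6)])
qed

text \<open>Adding a constant and negating both preserve congruence modulo 3. The first form, with
  the carry as \<open>c\<close>, serves the point classes; the second serves the line classes with
  the roles of \<open>x\<close> and \<open>h\<close> exchanged.\<close>

lemma net_embed:
  assumes "x \<in> reps"
  shows "net {h \<in> reps. inc x h} (\<lambda>h p. (dot (embed x p) h + c h) mod 3) offsets"
    and "net {h \<in> reps. inc x h} (\<lambda>h p. - dot (embed x p) h mod 3) offsets"
proof -
  have eq: "a mod 3 = b mod 3 \<longleftrightarrow> (a + d) mod 3 = (b + d) mod 3" "a mod 3 = b mod 3 \<longleftrightarrow> - a mod 3 = - b mod 3"
    for a b d :: int by (simp_all add: mod_eq_dvd_iff dvd_diff_commute)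
  have three: "a mod 3 \<in> {0, 1, 2}" for a :: int by (simp, presburger)
  show "net {h \<in> reps. inc x h} (\<lambda>h p. (dot (embed x p) h + c h) mod 3) offsets"
  proof -
    have "inj_on (\<lambda>p. ((dot (embed x p) h + c h) mod 3, (dot (embed x p) h' + c h') mod 3)) offsets"
      if "h \<in> {h \<in> reps. inc x h}" "h' \<in> {h \<in> reps. inc x h}" "h \<noteq> h'" for h h'
      using inj_on_embed[of x h h'] assms that by (simp add: inj_on_def eq(1)[symmetric])
    then show ?thesis unfolding net_def using three finite_offsets card_offsets by blast
  qed
  show "net {h \<in> reps. inc x h} (\<lambda>h p. - dot (embed x p) h mod 3) offsets"
  proof -
    have "inj_on (\<lambda>p. (- dot (embed x p) h mod 3, - dot (embed x p) h' mod 3)) offsets"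
      if "h \<in> {h \<in> reps. inc x h}" "h' \<in> {h \<in> reps. inc x h}" "h \<noteq> h'" for h h'
      using inj_on_embed[of x h h'] assms that by (simp add: inj_on_def eq(2)[symmetric])
    then show ?thesis unfolding net_def using three finite_offsets card_offsets by blast
  qed
qed

section \<open>Lifting coordinates to points and lines over the ring\<close>

fun lift :: "'r::comm_ring_1 \<Rightarrow> int \<times> int \<times> int \<Rightarrow> int \<times> int \<times> int \<Rightarrow> 'r vec3" where
  "lift \<theta> (x, y, z) (s, t, r) = (of_int x + \<theta> * of_int s, of_int y + \<theta> * of_int t, of_int z + \<theta> * of_int r)"

lemma dot_lift:
  assumes "\<theta> * \<theta> = 0"
  shows "dot (lift \<theta> x p) (lift \<theta> h m) = of_int (dot x h) + \<theta> * of_int (dot p h + dot m x)"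
proof -
  have [simp]: "\<theta> * (\<theta> * a) = 0" for a using assms by (simp flip: mult.assoc)
  show ?thesis by (cases x; cases p; cases h; cases m) (simp add: algebra_simps)
qed

text \<open>The equation can be solved for the coordinate with coefficient 1, and the other two
  coordinates are free parameters.\<close>

lemma is_line_orthogonal:
  fixes a b c :: "'r::comm_ring_1"
  assumes "a = 1 \<or> b = 1 \<or> c = 1"
  shows "is_line {v. dot (a, b, c) v = 0}"
  using assms
proof (elim disjE)
  assume "a = 1"
  let ?f = "\<lambda>(s, t). vadd (vsc (- b, 1, 0) s) (vsc (- c, 0, 1) t)"
  have "v \<in> range ?f" if "dot (a, b, c) v = 0" for v
  proof (cases v)
    case (fields x y z)
    with that \<open>a = 1\<close> have "x = - b * y - c * z" by (simp add: algebra_simps eq_neg_iff_add_eq_0)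
    then have "v = ?f (y, z)" using fields by simp
    then show ?thesis by blast
  qed
  then have "{v. dot (a, b, c) v = 0} = range ?f" using \<open>a = 1\<close> by auto
  moreover have "inj ?f" by (auto simp: inj_on_def)
  ultimately show ?thesis unfolding is_line_def by blast
next
  assume "b = 1"
  let ?f = "\<lambda>(s, t). vadd (vsc (1, - a, 0) s) (vsc (0, - c, 1) t)"
  have "v \<in> range ?f" if "dot (a, b, c) v = 0" for v
  proof (cases v)
    case (fields x y z)
    with that \<open>b = 1\<close> have "y = - a * x - c * z" by (simp add: algebra_simps eq_neg_iff_add_eq_0)
    then have "v = ?f (x, z)" using fields by simp
    then show ?thesis by blast
  qed
  then have "{v. dot (a, b, c) v = 0} = range ?f" using \<open>b = 1\<close> by auto
  moreover have "inj ?f" by (auto simp: inj_on_def)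
  ultimately show ?thesis unfolding is_line_def by blast
next
  assume "c = 1"
  let ?f = "\<lambda>(s, t). vadd (vsc (1, 0, - a) s) (vsc (0, 1, - b) t)"
  have "v \<in> range ?f" if "dot (a, b, c) v = 0" for v
  proof (cases v)
    case (fields x y z)
    with that \<open>c = 1\<close> have "z = - a * x - b * y" by (simp add: algebra_simps eq_neg_iff_add_eq_0)
    then have "v = ?f (x, y)" using fields by simp
    then show ?thesis by blast
  qed
  then have "{v. dot (a, b, c) v = 0} = range ?f" using \<open>c = 1\<close> by auto
  moreover have "inj ?f" by (auto simp: inj_on_def)
  ultimately show ?thesis unfolding is_line_def by blast
qed

lemma is_line_lift:
  assumes "h \<in> reps" "m \<in> offsets"
  shows "is_line {v. dot (lift \<theta> h (embed h m)) v = 0}"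
proof -
  obtain a b c where abc: "lift \<theta> h (embed h m) = (a, b, c)" by (cases "lift \<theta> h (embed h m)")
  then have "a = 1 \<or> b = 1 \<or> c = 1" using assms unfolding reps_def offsets_def by auto
  then show ?thesis using abc is_line_orthogonal by simp
qed

lemma range_vsc_unit:
  fixes v :: "'r::comm_ring_1 vec3"
  assumes "a * i = 1"
  shows "range (vsc (vsc v i)) = range (vsc v)"
proof -
  have 1: "vsc (vsc v i) b = vsc v (i * b)" for b by (cases v) (simp add: mult.assoc)
  have 2: "vsc v b = vsc (vsc v i) (a * b)" for b
  proof -
    have "i * (a * b) = b" using assms by (metis mult.assoc mult.commute mult_1)
    then show ?thesis using 1 by simp
  qed
  show ?thesis using 1 2 by (metis (no_types, opaque_lifting) image_subsetI rangeI subset_antisym)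
qed

text \<open>\<open>\<kappa>\<close> is the carry: it is 1 for \<open>\<int>\<^sub>9\<close> with \<open>\<theta> = 3\<close> and 0 for \<open>F\<^sub>3[X]/(X\<^sup>2)\<close> with \<open>\<theta> = X\<close>. It only
  shifts the labels of the segments.\<close>
locale small_chain_ring =
  fixes \<theta> :: "'r::{comm_ring_1,finite}" and \<kappa> :: int
  assumes theta_sq: "\<theta> * \<theta> = 0" and theta_nz: "\<theta> \<noteq> 0"
    and three: "3 = of_int \<kappa> * \<theta>" and three_theta: "3 * \<theta> = 0"
    and decomp: "\<exists>e\<in>{-1, 0, 1}. \<exists>f\<in>{-1, 0, 1}. r = of_int e + \<theta> * of_int f"
begin

text \<open>If \<open>e\<close> is 1 or -1, then \<open>of_int e - \<theta> * of_int f\<close> is an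
  inverse, because \<open>\<theta>\<close> squares to zero.\<close>

lemma unit_or_multiple: "(\<exists>i. r * i = 1) \<or> (\<exists>f\<in>{-1, 0, 1}. r = \<theta> * of_int f)"
proof -
  obtain e f where ef: "e \<in> {-1, 0, 1}" "f \<in> {-1, 0, 1}" "r = of_int e + \<theta> * of_int f"
    using decomp[of r] by blast
  have [simp]: "\<theta> * (\<theta> * a) = 0" for a using theta_sq by (simp flip: mult.assoc)
  show ?thesis
  proof (cases "e = 0")
    case False
    then have "r * (of_int e - \<theta> * of_int f) = 1" using ef by (auto simp: algebra_simps)
    then show ?thesis by blast
  qed (use ef in auto)
qed

lemma point_normal_form:
  assumes "is_point Q"
  shows "\<exists>x\<in>reps. \<exists>p\<in>offsets. Q = range (vsc (lift \<theta> x (embed x p)))"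
proof -
  obtain v where v: "Q = range (vsc v)" "inj (vsc v)" using assms by (auto simp: is_point_def)
  obtain a b c where abc: "v = (a, b, c)" by (cases v)
  \<comment> \<open>Multiplication by \<open>\<theta>\<close> kills the \<open>\<theta>\<close>-part
    of \<open>of_int f' * i\<close>, so multiples of \<open>\<theta>\<close> keep a coefficient in
    \<open>{-1, 0, 1}\<close> after scaling.\<close>
  have mult: "\<exists>f\<in>{-1, 0, 1}. \<theta> * of_int f' * i = \<theta> * of_int f" for f' :: int and i
  proof -
    obtain e f where ef: "e \<in> {-1, 0, 1}" "of_int f' * i = of_int e + \<theta> * of_int f"
      using decomp[of "of_int f' * i"] by blast
    then have "\<theta> * of_int f' * i = \<theta> * of_int e"
      using theta_sq by (simp add: mult.assoc distrib_left) (simp flip: mult.assoc)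
    then show ?thesis using ef by blast
  qed
  have decomp': "\<exists>e f. e \<in> {-1, 0, 1} \<and> f \<in> {-1, 0, 1} \<and> r = of_int e + \<theta> * of_int f" for r
    using decomp[of r] by blast
  consider i where "a * i = 1" | i f where "a = \<theta> * of_int f" "b * i = 1"
    | i f g where "a = \<theta> * of_int f" "b = \<theta> * of_int g" "c * i = 1"
    | f g k where "a = \<theta> * of_int f" "b = \<theta> * of_int g" "c = \<theta> * of_int k"
    using unit_or_multiple[of a] unit_or_multiple[of b] unit_or_multiple[of c] by blast
  \<comment> \<open>The cases locate the first unit coordinate, which scaling turns into the pivot
    1.\<close>
  then show ?thesis
  proof cases
    case 1
    obtain e f where ef: "e \<in> {-1, 0, 1}" "f \<in> {-1, 0, 1}" "b * i = of_int e + \<theta> * of_int f"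
      using decomp' by blast
    obtain e' f' where ef': "e' \<in> {-1, 0, 1}" "f' \<in> {-1, 0, 1}" "c * i = of_int e' + \<theta> * of_int f'"
      using decomp' by blast
    have "vsc v i = lift \<theta> (1, e, e') (embed (1, e, e') (f, f'))" using abc 1 ef ef' by simp
    moreover have "(1, e, e') \<in> reps" "(f, f') \<in> offsets" using ef ef' by (auto simp: reps_def offsets_def)
    ultimately show ?thesis using range_vsc_unit[OF 1] v(1) by metis
  next
    case (2 i k)
    obtain f where f: "f \<in> {-1, 0, 1}" "a * i = \<theta> * of_int f" using mult 2 by metis
    obtain e' f' where ef': "e' \<in> {-1, 0, 1}" "f' \<in> {-1, 0, 1}" "c * i = of_int e' + \<theta> * of_int f'"
      using decomp' by blast
    have "vsc v i = lift \<theta> (0, 1, e') (embed (0, 1, e') (f, f'))" using abc 2(2) f ef' by simp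
    moreover have "(0, 1, e') \<in> reps" "(f, f') \<in> offsets" using f ef' by (auto simp: reps_def offsets_def)
    ultimately show ?thesis using range_vsc_unit[OF 2(2)] v(1) by metis
  next
    case (3 i k l)
    obtain f where f: "f \<in> {-1, 0, 1}" "a * i = \<theta> * of_int f" using mult 3 by metis
    obtain f' where f': "f' \<in> {-1, 0, 1}" "b * i = \<theta> * of_int f'" using mult 3 by metis
    have "vsc v i = lift \<theta> (0, 0, 1) (embed (0, 0, 1) (f, f'))" using abc 3(3) f f' by simp
    moreover have "(0, 0, 1) \<in> reps" "(f, f') \<in> offsets" using f f' by (auto simp: reps_def offsets_def)
    ultimately show ?thesis using range_vsc_unit[OF 3(3)] v(1) by metis
  next
    case (4 f g k)
    \<comment> \<open>Without a unit coordinate, \<open>\<theta>\<close> annihilates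
      \<open>v\<close>, so \<open>v\<close> does not generate a free module.\<close>
    have "\<theta> * y * \<theta> = 0" for y using theta_sq by (metis mult.assoc mult.commute mult_zero_left)
    then have "vsc v \<theta> = vsc v 0" using abc 4 by simp
    then show ?thesis using v(2) theta_nz by (auto dest: injD)
  qed
qed

text \<open>Replacing 3 by \<open>of_int \<kappa> * \<theta>\<close> turns the product into
  \<open>\<theta>\<close> times an integer. Equality of labels makes that integer divisible by 3,
  and \<open>3 * \<theta> = 0\<close>.\<close>

lemma incident:
  assumes "inc x h"
    and eq: "(dot (embed x p) h + \<kappa> * (dot x h div 3)) mod 3 = - dot (embed h m) x mod 3"
  shows "range (vsc (lift \<theta> x (embed x p))) \<subseteq> {v. dot (lift \<theta> h (embed h m)) v = 0}"
proof -
  obtain k where k: "dot x h = 3 * k" using assms(1) by (auto simp: inc_def)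
  have "(dot (embed x p) h + \<kappa> * k + dot (embed h m) x) mod 3 = 0"
    using eq k by (simp add: mod_eq_dvd_iff mod_0_imp_dvd dvd_imp_mod_0)
  then obtain l where l: "dot (embed x p) h + \<kappa> * k + dot (embed h m) x = 3 * l" by auto
  have "dot (lift \<theta> x (embed x p)) (lift \<theta> h (embed h m))
      = 3 * of_int k + \<theta> * of_int (dot (embed x p) h + dot (embed h m) x)"
    unfolding dot_lift[OF theta_sq] k by simp
  also have "\<dots> = \<theta> * of_int (dot (embed x p) h + \<kappa> * k + dot (embed h m) x)"
    unfolding three by (simp add: algebra_simps)
  also have "\<dots> = (3 * \<theta>) * of_int l" unfolding l by simp
  finally have "dot (lift \<theta> h (embed h m)) (lift \<theta> x (embed x p)) = 0"
    using three_theta by (simp add: dot_commute)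
  then show ?thesis by (auto simp: dot_vsc)
qed

lemma no_arc: "\<not> proj_arc (S :: 'r vec3 set set) 63 7"
proof
  assume arc: "proj_arc S 63 7"
  define pt where "pt = (\<lambda>(x, p). range (vsc (lift \<theta> x (embed x p))))"
  have "\<exists>g. \<forall>Q\<in>S. g Q \<in> reps \<times> offsets \<and> pt (g Q) = Q"
    using arc point_normal_form unfolding proj_arc_def pt_def by (intro bchoice) fastforce
  then obtain g where g: "\<And>Q. Q \<in> S \<Longrightarrow> g Q \<in> reps \<times> offsets" "\<And>Q. Q \<in> S \<Longrightarrow> pt (g Q) = Q" by blast
  \<comment> \<open>Choosing one index per point spares proving that \<open>pt\<close> is injective.\<close>
  have inj: "inj_on g S" by (metis g(2) inj_onI)
  define \<sigma> where "\<sigma> x h p = (dot (embed x p) h + \<kappa> * (dot x h div 3)) mod 3" for x h p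
  define \<tau> where "\<tau> h x m = - dot (embed h m) x mod 3" for h x m
  have "arc63 reps inc offsets \<sigma> \<tau> (g ` S)"
  proof
    have filter_set: "Set.filter P B = {b \<in> B. P b}" for P and B :: "(int \<times> int \<times> int) set" by auto
    show "finite reps" by (simp add: reps_def)
    show "card reps = 13" by (rule card_reps)
    show sym: "inc x h \<longleftrightarrow> inc h x" for x h by (simp add: inc_def dot_commute)
    show "card {h \<in> reps. inc x h} = 4" if "x \<in> reps" for x
      using card_filter_inc that by (simp add: filter_set)
    show "card {h \<in> reps. inc x h \<and> inc y h} = 1" if "x \<in> reps" "y \<in> reps" "x \<noteq> y" for x y
      using card_filter_join that by (simp add: filter_set)
    show "net {h \<in> reps. inc x h} (\<sigma> x) offsets" if "x \<in> reps" for x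
      using net_embed(1)[OF that, of "\<lambda>h. \<kappa> * (dot x h div 3)"] by (simp add: \<sigma>_def[abs_def])
    show "net {x \<in> reps. inc x h} (\<tau> h) offsets" if "h \<in> reps" for h
      using net_embed(2)[OF that] by (simp add: \<tau>_def[abs_def] sym[of _ h])
    show "g ` S \<subseteq> reps \<times> offsets" using g by blast
    show "card (g ` S) = 63" using arc inj by (simp add: proj_arc_def card_image)
    show "card {(x, p) \<in> g ` S. inc x h \<and> \<sigma> x h p = \<tau> h x m} \<le> 7" if "h \<in> reps" "m \<in> offsets" for h m
    proof -
      let ?L = "{v. dot (lift \<theta> h (embed h m)) v = 0}"
      \<comment> \<open>Each index counted by the model comes from an arc point on the ring line
        \<open>?L\<close>, so the bound 7 carries over.\<close>
      have "{(x, p) \<in> g ` S. inc x h \<and> \<sigma> x h p = \<tau> h x m} \<subseteq> g ` {Q \<in> S. Q \<subseteq> ?L}"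
      proof
        fix z assume "z \<in> {(x, p) \<in> g ` S. inc x h \<and> \<sigma> x h p = \<tau> h x m}"
        moreover obtain x p where z: "z = (x, p)" by (cases z)
        ultimately have "z \<in> g ` S" "inc x h" "\<sigma> x h p = \<tau> h x m" by simp_all
        then obtain Q where *: "Q \<in> S" "g Q = z" "inc x h" "\<sigma> x h p = \<tau> h x m" by blast
        then have "pt (x, p) \<subseteq> ?L" using incident[of x h p m] by (simp add: pt_def \<sigma>_def \<tau>_def)
        then show "z \<in> g ` {Q \<in> S. Q \<subseteq> ?L}" using *(1,2) z g(2)[of Q] by force
      qed
      then have "card {(x, p) \<in> g ` S. inc x h \<and> \<sigma> x h p = \<tau> h x m} \<le> card (g ` {Q \<in> S. Q \<subseteq> ?L})"
        by (intro card_mono) auto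
      also have "\<dots> \<le> card {Q \<in> S. Q \<subseteq> ?L}" by (intro card_image_le) auto
      also have "\<dots> \<le> 7" using arc is_line_lift[OF that, of \<theta>] unfolding proj_arc_def by blast
      finally show ?thesis .
    qed
  qed
  then show False by (rule arc63.contradiction)
qed

lemma max_arc_le: "max_arc TYPE('r) 7 \<le> 62"
proof -
  let ?K = "{k. \<exists>S :: 'r vec3 set set. proj_arc S k 7}"
  have "k \<le> 62" if "k \<in> ?K" for k
  proof (rule ccontr)
    assume "\<not> k \<le> 62"
    from that obtain S :: "'r vec3 set set" where S: "proj_arc S k 7" by blast
    \<comment> \<open>Subsets of arcs are arcs, so a larger arc can be cut down to exactly 63
      points.\<close>
    then obtain T where T: "T \<subseteq> S" "card T = 63"
      using \<open>\<not> k \<le> 62\<close> obtain_subset_with_card_n[of 63 S] by (auto simp: proj_arc_def)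
    have "card {Q \<in> T. Q \<subseteq> L} \<le> card {Q \<in> S. Q \<subseteq> L}" for L
      using T by (intro card_mono) auto
    then have "proj_arc T 63 7" using S T unfolding proj_arc_def by (meson order_trans subset_trans)
    then show False using no_arc by blast
  qed
  \<comment> \<open>The empty arc makes the set nonempty, as \<open>Max\<close> requires.\<close>
  moreover have "proj_arc ({} :: 'r vec3 set set) 0 7" by (simp add: proj_arc_def)
  then have "?K \<noteq> {}" by blast
  moreover have "finite ?K" using calculation(1) by (meson finite_nat_set_iff_bounded_le)
  ultimately show ?thesis unfolding max_arc_def by simp
qed

end

section \<open>The two rings of order nine\<close>

interpretation Z9: small_chain_ring "3 :: 9" 1
proof
  have residue: "r \<in> {0, 1, 2, 3, 4, 5, 6, 7, 8}" for r :: 9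
  proof (cases r)
    case (of_int z)
    then have "z = 0 \<or> z = 1 \<or> z = 2 \<or> z = 3 \<or> z = 4 \<or> z = 5 \<or> z = 6 \<or> z = 7 \<or> z = 8" by auto
    then show ?thesis using of_int(1) by (elim disjE) simp_all
  qed
  \<comment> \<open>Balanced ternary: two digits from \<open>{-1, 0, 1}\<close> represent all
    residues modulo 9.\<close>
  show "\<exists>e\<in>{-1, 0, 1}. \<exists>f\<in>{-1, 0, 1}. r = of_int e + 3 * of_int f" for r :: 9
    using residue[of r] by (elim insertE emptyE) simp_all
qed simp_all

interpretation S3: small_chain_ring "Dual 0 1 :: S3" 0
proof
  \<comment> \<open>As a sum of ones the numeral can be evaluated componentwise, where it vanishes
    in characteristic 3.\<close>
  have three: "(3 :: S3) = 1 + 1 + 1" by simp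
  show "(3 :: S3) = of_int 0 * Dual 0 1"
    unfolding three by (simp add: one_dual_def zero_dual_def)
  show "3 * (Dual 0 1 :: S3) = 0"
    unfolding three by (simp add: one_dual_def zero_dual_def)
  show "Dual 0 1 * (Dual 0 1 :: S3) = 0" "(Dual 0 1 :: S3) \<noteq> 0" by (simp_all add: zero_dual_def)
  have residue: "a \<in> {0, 1, 2}" for a :: 3
  proof (cases a)
    case (of_int z)
    then have "z = 0 \<or> z = 1 \<or> z = 2" by auto
    then show ?thesis using of_int(1) by (elim disjE) simp_all
  qed
  have F3: "\<exists>e\<in>{-1, 0, 1}. a = of_int e" for a :: 3
    using residue[of a] by (elim insertE emptyE) simp_all
  have dual: "of_int e + Dual 0 1 * of_int f = (Dual (of_int e) (of_int f) :: S3)"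
    if "e \<in> {-1, 0, 1}" "f \<in> {-1, 0, 1}" for e f :: int
    using that by (auto simp: one_dual_def zero_dual_def)
  show "\<exists>e\<in>{-1, 0, 1}. \<exists>f\<in>{-1, 0, 1}. r = of_int e + Dual 0 1 * of_int f" for r :: S3
  proof (cases r)
    case (Dual a b)
    obtain e where e: "e \<in> {-1, 0, 1}" "a = of_int e" using F3[of a] by blast
    obtain f where f: "f \<in> {-1, 0, 1}" "b = of_int f" using F3[of b] by blast
    have "r = of_int e + Dual 0 1 * of_int f" using dual[OF e(1) f(1)] Dual e f by simp
    then show ?thesis using e(1) f(1) by blast
  qed
qed

theorem theorem4p13:
  shows "max_arc TYPE(9) 7 \<le> 62 \<and> max_arc TYPE(S3) 7 \<le> 62"
  using Z9.max_arc_le S3.max_arc_le by blast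

end
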